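(* Let $\mathrm{K}_V^{\mathbf t}$ be a complete $\mathbf t$-spread $d$-partite hypergraph. Then its edge ideal $I(\mathrm{K}_V^{\mathbf t})$ has linear quotients.
   Context: Setting. Let $n,d\ge 1$ be integers, $[n]=\{1,\dots,n\}$, and let $\mathbf t=(t_1,\dots,t_{d-1})$ be a vector of integers with $t_i\ge 1$ for all $i$. Let $V=\{V_1,\dots,V_d\}$ be a family of nonempty, pairwise disjoint subsets of $[n]$ such that $p<q$ whenever $p\in V_i$, $q\in V_j$ and $i<j$. A $\mathbf t$-spread edge is a set $\{k_1,\dots,k_d\}$ with $k_j\in V_j$ for $j=1,\dots,d$ and $k_j-k_{j-1}\ge t_{j-1}$ for $j=2,\dots,d$. The complete $\mathbf t$-spread $d$-partite hypergraph $\mathrm{K}_V^{\mathbf t}$ is the hypergraph with vertex set $V(\mathrm{K}_V^{\mathbf t})=V_1\cup\dots\cup V_d$ whose edges are all the $\mathbf t$-spread edges. Standing assumption: $\mathrm{K}_V^{\mathbf t}$ has no isolated vertices, i.e. every vertex belongs to at least one edge. Let $\mathbb{K}$ be a field and $S=\mathbb{K}[x_1,\dots,x_n]$. The edge ideal $I(\mathrm{K}_V^{\mathbf t})\subset S$ is the ideal generated by the monomials $x_{k_1}\cdots x_{k_d}$, where $\{k_1,\dots,k_d\}$ runs over the edges of $\mathrm{K}_V^{\mathbf t}$. For a monomial ideal $I$, $\mathcal{G}(I)$ denotes its unique minimal set of monomial generators. The ideal $I$ has linear quotients if $\mathcal{G}(I)$ admits an ordering $u_1,\dots,u_r$ such that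 for all $i=2,\dots,r$ the colon ideal $(u_1,\dots,u_{i-1}):(u_i)$ is generated by variables. *)

theory Defs
  imports Main "HOL-Library.Poly_Mapping" "HOL-Library.Disjoint_Sets" "HOL-Algebra.Ideal"
begin

text \<open>
  Exponent vectors are finitely supported functions on the natural numbers, and the
  monoid algebra over them is the polynomial ring in the variables \<open>x\<^sub>0, x\<^sub>1, \<dots>\<close>.
  The ring \<open>S = K[x\<^sub>1, \<dots>, x\<^sub>n]\<close> is its subring of polynomials involving only the
  variables with index in \<open>{1..n}\<close>; all ideals below are ideals of \<open>S\<close>.
\<close>

type_synonym 'k mpoly = "(nat \<Rightarrow>\<^sub>0 nat) \<Rightarrow>\<^sub>0 'k"

definition exponents :: "nat \<Rightarrow> (nat \<Rightarrow>\<^sub>0 nat) set"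
  where "exponents n = {m. Poly_Mapping.keys m \<subseteq> {1..n}}"

definition poly_ring :: "nat \<Rightarrow> ('k::field) mpoly ring"
  where "poly_ring n =
    \<lparr>carrier = {p. Poly_Mapping.keys p \<subseteq> exponents n},
     mult = (*), one = 1, zero = 0, add = (+)\<rparr>"

lemma cring_poly_ring: "cring (poly_ring n :: ('k::field) mpoly ring)"
proof -
  have add: "p + q \<in> carrier (poly_ring n)"
    if "p \<in> carrier (poly_ring n)" "q \<in> carrier (poly_ring n)" for p q :: "'k mpoly"
    using that Poly_Mapping.keys_add[of p q] by (auto simp: poly_ring_def)
  have mult: "p * q \<in> carrier (poly_ring n)"
    if "p \<in> carrier (poly_ring n)" "q \<in> carrier (poly_ring n)" for p q :: "'k mpoly"
  proof -
    have "a + b \<in> exponents n" if "a \<in> exponents n" "b \<in> exponents n" for a b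
      using that Poly_Mapping.keys_add[of a b] by (auto simp: exponents_def)
    then show ?thesis
      using that keys_mult[of p q] by (fastforce simp: poly_ring_def)
  qed
  have uminus: "- p \<in> carrier (poly_ring n)" if "p \<in> carrier (poly_ring n)" for p :: "'k mpoly"
    using that by (simp add: poly_ring_def)
  have zero_one: "(0 :: 'k mpoly) \<in> carrier (poly_ring n)" "(1 :: 'k mpoly) \<in> carrier (poly_ring n)"
    by (simp_all add: poly_ring_def exponents_def)
  have ops: "p \<oplus>\<^bsub>poly_ring n\<^esub> q = p + q" "p \<otimes>\<^bsub>poly_ring n\<^esub> q = p * q"
    "\<zero>\<^bsub>poly_ring n\<^esub> = 0" "\<one>\<^bsub>poly_ring n\<^esub> = 1" for p q :: "'k mpoly"
    by (simp_all add: poly_ring_def)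
  have "abelian_group (poly_ring n :: 'k mpoly ring)"
  proof (rule abelian_groupI, unfold ops)
    show "\<exists>q\<in>carrier (poly_ring n). q + p = 0" if "p \<in> carrier (poly_ring n)" for p :: "'k mpoly"
      using uminus[OF that] by (intro bexI[of _ "- p"]) simp_all
  qed (use add zero_one in \<open>simp_all add: add.assoc add.commute\<close>)
  moreover have "comm_monoid (poly_ring n :: 'k mpoly ring)"
    by (rule comm_monoidI, unfold ops) (use mult zero_one in \<open>simp_all add: mult.assoc mult.commute\<close>)
  ultimately show ?thesis
    by (rule cringI) (simp add: ops distrib_right)
qed

definition monom :: "(nat \<Rightarrow>\<^sub>0 nat) \<Rightarrow> ('k::field) mpoly"
  where "monom m = Poly_Mapping.single m 1"

definition var :: "nat \<Rightarrow> ('k::field) mpoly"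
  where "var i = monom (Poly_Mapping.single i 1)"

definition is_minimal_monomial_generating_set ::
    "nat \<Rightarrow> ('k::field) mpoly set \<Rightarrow> 'k mpoly set \<Rightarrow> bool"
  where "is_minimal_monomial_generating_set n I G \<longleftrightarrow>
    G \<subseteq> monom ` exponents n \<and> Idl\<^bsub>poly_ring n\<^esub> G = I \<and>
    (\<forall>G'. G' \<subset> G \<longrightarrow> Idl\<^bsub>poly_ring n\<^esub> G' \<noteq> I)"

text \<open>
  For a monomial ideal the minimal monomial generating set exists and is unique; for an ideal
  that is not a monomial ideal the following value is unspecified.
\<close>

definition minimal_generators :: "nat \<Rightarrow> ('k::field) mpoly set \<Rightarrow> 'k mpoly set"
  where "minimal_generators n I = (THE G. is_minimal_monomial_generating_set n I G)"

definition colon_ideal :: "('a, 'b) ring_scheme \<Rightarrow> 'a set \<Rightarrow> 'a set \<Rightarrow> 'a set"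
  where "colon_ideal R I J = {a \<in> carrier R. \<forall>b\<in>J. a \<otimes>\<^bsub>R\<^esub> b \<in> I}"

text \<open>The list is indexed from 0: \<open>us ! i\<close> is preceded by the elements of \<open>take i us\<close>.\<close>

definition has_linear_quotients :: "nat \<Rightarrow> ('k::field) mpoly set \<Rightarrow> bool"
  where "has_linear_quotients n I \<longleftrightarrow>
    (\<exists>us. distinct us \<and> set us = minimal_generators n I \<and>
      (\<forall>i\<in>{1..<length us}. \<exists>X\<subseteq>{1..n}.
        colon_ideal (poly_ring n)
          (Idl\<^bsub>poly_ring n\<^esub> (set (take i us))) (Idl\<^bsub>poly_ring n\<^esub> {us ! i})
        = Idl\<^bsub>poly_ring n\<^esub> (var ` X)))"

record hypergraph =
  vertices :: "nat set"
  edges :: "nat set set"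

definition no_isolated_vertices :: "hypergraph \<Rightarrow> bool"
  where "no_isolated_vertices H \<longleftrightarrow> (\<forall>v\<in>vertices H. \<exists>e\<in>edges H. v \<in> e)"

definition edge_ideal :: "nat \<Rightarrow> hypergraph \<Rightarrow> ('k::field) mpoly set"
  where "edge_ideal n H = Idl\<^bsub>poly_ring n\<^esub> ((\<lambda>e. \<Prod>k\<in>e. var k) ` edges H)"

text \<open>
  The vectors \<open>(t\<^sub>1, \<dots>, t\<^bsub>d-1\<^esub>)\<close>, \<open>(V\<^sub>1, \<dots>, V\<^sub>d)\<close> and \<open>(k\<^sub>1, \<dots>, k\<^sub>d)\<close> are functions on the
  natural numbers of which only the values at the indices shown matter.
\<close>

definition spread_edge :: "nat \<Rightarrow> (nat \<Rightarrow> int) \<Rightarrow> (nat \<Rightarrow> nat set) \<Rightarrow> nat set \<Rightarrow> bool"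
  where "spread_edge d t V e \<longleftrightarrow>
    (\<exists>k. e = k ` {1..d} \<and> (\<forall>j\<in>{1..d}. k j \<in> V j) \<and>
      (\<forall>j\<in>{2..d}. int (k j) - int (k (j - 1)) \<ge> t (j - 1)))"

definition complete_spread_hypergraph ::
    "nat \<Rightarrow> (nat \<Rightarrow> int) \<Rightarrow> (nat \<Rightarrow> nat set) \<Rightarrow> hypergraph"
  where "complete_spread_hypergraph d t V =
    \<lparr>vertices = (\<Union>i\<in>{1..d}. V i), edges = {e. spread_edge d t V e}\<rparr>"

end

theory Submission
  imports Defs "HOL-Library.List_Lexorder"
begin

text \<open>
  List every edge as its increasing sequence of vertices and order the edges
  lexicographically. Let \<open>a\<close> precede \<open>b\<close> and let \<open>p\<close> be the first position where they differ,
  so that \<open>a\<^sub>p < b\<^sub>p\<close>. Replacing \<open>b\<^sub>p\<close> by \<open>a\<^sub>p\<close> in \<open>b\<close> gives an edge again: the gap on the left is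
  the gap that \<open>a\<close> has there, because the two sequences agree before \<open>p\<close>, and the gap on the right
  only grows. The new edge \<open>c\<close> still precedes \<open>b\<close>, and \<open>c - b = {a\<^sub>p}\<close> (\<open>spread_list_exchange\<close>).

  On the algebraic side, this says that whenever an earlier generator \<open>x\<^sub>a\<close> divides \<open>x\<^sub>b\<close> times a
  monomial \<open>w\<close>, the monomial \<open>w\<close> is divisible by the variable of \<open>a\<^sub>p \<in> a - b\<close>, and this variable
  itself lies in the colon ideal, since \<open>x\<^sub>c\<close> divides its product with \<open>x\<^sub>b\<close>. So the colon ideals
  are generated by variables (\<open>linear_quotients_criterion\<close>). All ideals that occur are monomial
  ideals, hence comparing them reduces to comparing exponent vectors (\<open>genideal_monomials\<close>,
  \<open>colon_ideal_monomials\<close>). All edges have \<open>d\<close> elements, so none contains another and the edge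
  monomials are the minimal generators (\<open>minimal_generators_antichain\<close>).
\<close>

section \<open>Ideals generated by monomials\<close>

definition exp_dvd :: "(nat \<Rightarrow>\<^sub>0 nat) \<Rightarrow> (nat \<Rightarrow>\<^sub>0 nat) \<Rightarrow> bool"
  where "exp_dvd m k \<longleftrightarrow> (\<forall>x. Poly_Mapping.lookup m x \<le> Poly_Mapping.lookup k x)"

lemma exp_dvd_trans: "exp_dvd a b \<Longrightarrow> exp_dvd b c \<Longrightarrow> exp_dvd a c"
  unfolding exp_dvd_def using order_trans by blast

lemma exp_dvd_antisym: "exp_dvd a b \<Longrightarrow> exp_dvd b a \<Longrightarrow> a = b"
  unfolding exp_dvd_def by (intro poly_mapping_eqI) (simp add: antisym)

lemma exp_dvd_add: "exp_dvd a b \<Longrightarrow> exp_dvd a (c + b)"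
  unfolding exp_dvd_def by (simp add: lookup_add trans_le_add2)

lemma exp_dvd_diff_add:
  assumes "exp_dvd m k"
  shows "k - m + m = k"
  using assms by (intro poly_mapping_eqI) (simp add: exp_dvd_def lookup_add lookup_minus)

lemma keys_monom [simp]: "Poly_Mapping.keys (monom m :: ('k::field) mpoly) = {m}"
  by (simp add: monom_def)

lemma inj_monom: "inj (monom :: _ \<Rightarrow> ('k::field) mpoly)"
  by (rule injI) (metis keys_monom singleton_inject)

lemma exponents_diff: "k \<in> exponents n \<Longrightarrow> k - m \<in> exponents n"
  unfolding exponents_def
  by (auto simp: in_keys_iff lookup_minus subset_iff)

lemma poly_ring_simps [simp]:
  "p \<in> carrier (poly_ring n) \<longleftrightarrow> Poly_Mapping.keys p \<subseteq> exponents n"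
  "p \<oplus>\<^bsub>poly_ring n\<^esub> q = p + q" "p \<otimes>\<^bsub>poly_ring n\<^esub> q = p * q"
  "\<zero>\<^bsub>poly_ring n\<^esub> = 0" "\<one>\<^bsub>poly_ring n\<^esub> = 1" for p q :: "('k::field) mpoly"
  by (simp_all add: poly_ring_def)

lemma sum_of_terms: "p = (\<Sum>k\<in>Poly_Mapping.keys p. Poly_Mapping.single k (Poly_Mapping.lookup p k))"
  for p :: "('k::field) mpoly"
  by (rule poly_mapping_eqI)
    (simp add: lookup_sum lookup_single when_def sum.delta in_keys_iff)

text \<open>
  The polynomials all of whose terms are multiples of generators form an ideal, and each such term
  lies in every ideal containing the generators. Membership in a monomial ideal is thereby a
  condition on the support alone.
\<close>
lemma genideal_monomials:
  fixes M :: "(nat \<Rightarrow>\<^sub>0 nat) set"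
  assumes M: "M \<subseteq> exponents n"
  shows "Idl\<^bsub>poly_ring n\<^esub> (monom ` M :: ('k::field) mpoly set) =
    {p. Poly_Mapping.keys p \<subseteq> exponents n \<and> (\<forall>k\<in>Poly_Mapping.keys p. \<exists>m\<in>M. exp_dvd m k)}"
    (is "?I = ?T")
proof -
  interpret cring "poly_ring n :: 'k mpoly ring" by (rule cring_poly_ring)
  have in_carrier: "(monom ` M :: 'k mpoly set) \<subseteq> carrier (poly_ring n)"
    using M by auto
  have "ideal ?T (poly_ring n)"
  proof (rule idealI[OF ring_axioms])
    have add: "p + q \<in> ?T" if "p \<in> ?T" "q \<in> ?T" for p q
      using that Poly_Mapping.keys_add[of p q] by blast
    have inv: "\<ominus>\<^bsub>poly_ring n\<^esub> p \<in> ?T" if p: "p \<in> ?T" for p :: "'k mpoly"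
    proof -
      have "\<ominus>\<^bsub>poly_ring n\<^esub> p = - p"
        by (rule minus_equality) (use p in simp_all)
      then show ?thesis using p by simp
    qed
    show "subgroup ?T (add_monoid (poly_ring n))"
    proof (rule add.subgroupI)
      show "?T \<noteq> {}" by (auto intro: exI[of _ 0])
      show "?T \<subseteq> carrier (poly_ring n)" by auto
      show "p \<oplus>\<^bsub>poly_ring n\<^esub> q \<in> ?T" if "p \<in> ?T" "q \<in> ?T" for p q
        unfolding poly_ring_simps using that by (rule add)
    qed (rule inv)
  next
    fix p x :: "'k mpoly"
    assume p: "p \<in> ?T" and x: "x \<in> carrier (poly_ring n)"
    have "x * p \<in> carrier (poly_ring n)"
      using m_closed[OF x, of p] p by simp
    moreover have "\<exists>m\<in>M. exp_dvd m k" if "k \<in> Poly_Mapping.keys (x * p)" for k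
      using that keys_mult[of x p] p exp_dvd_add by blast
    ultimately have "x * p \<in> ?T" by simp
    then show "x \<otimes>\<^bsub>poly_ring n\<^esub> p \<in> ?T" "p \<otimes>\<^bsub>poly_ring n\<^esub> x \<in> ?T"
      by (simp_all add: mult.commute)
  qed
  moreover have "monom ` M \<subseteq> ?T"
    using M by (auto simp: exp_dvd_def)
  ultimately have "?I \<subseteq> ?T"
    by (rule genideal_minimal)
  moreover have "p \<in> ?I" if p: "p \<in> ?T" for p
  proof -
    interpret I: ideal ?I "poly_ring n"
      by (rule genideal_ideal[OF in_carrier])
    have monomial: "Poly_Mapping.single k (Poly_Mapping.lookup p k) \<in> ?I" if k: "k \<in> Poly_Mapping.keys p" for k
    proof -
      obtain m where m: "m \<in> M" "exp_dvd m k" using p k by auto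
      have "monom m \<in> ?I" using genideal_self[OF in_carrier] m(1) by auto
      moreover have "Poly_Mapping.single (k - m) (Poly_Mapping.lookup p k) \<in> carrier (poly_ring n)"
        using p k exponents_diff[of k n m] by auto
      ultimately have "Poly_Mapping.single (k - m) (Poly_Mapping.lookup p k) * monom m \<in> ?I"
        using I.I_l_closed by fastforce
      then show ?thesis
        by (simp add: monom_def mult_single exp_dvd_diff_add[OF m(2)])
    qed
    have sum: "(\<Sum>k\<in>A. f k) \<in> ?I" if "finite A" "\<And>k. k \<in> A \<Longrightarrow> f k \<in> ?I"
      for A and f :: "(nat \<Rightarrow>\<^sub>0 nat) \<Rightarrow> 'k mpoly"
      using that
    proof (induction rule: finite_induct)
      case empty
      then show ?case using I.zero_closed by simp
    next
      case (insert a F)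
      then show ?case using I.a_closed[of "f a" "sum f F"] by simp
    qed
    show ?thesis
      by (subst sum_of_terms) (rule sum, auto intro: monomial)
  qed
  ultimately show ?thesis by blast
qed

lemma monom_in_genideal:
  assumes "M \<subseteq> exponents n" "k \<in> exponents n"
  shows "(monom k :: ('k::field) mpoly) \<in> Idl\<^bsub>poly_ring n\<^esub> (monom ` M) \<longleftrightarrow> (\<exists>m\<in>M. exp_dvd m k)"
  using assms by (simp add: genideal_monomials)

text \<open>
  Two monomial generating sets of one ideal divide each other elementwise. Going from a generator in
  the antichain to a divisor in the other set and back again must return to the start, so every
  generating set contains the antichain; this gives both its minimality and the uniqueness that the
  definite description in \<open>minimal_generators\<close> relies on.
\<close>
lemma minimal_generators_antichain:
  fixes M :: "(nat \<Rightarrow>\<^sub>0 nat) set"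
  assumes M: "M \<subseteq> exponents n"
    and antichain: "\<And>a b. a \<in> M \<Longrightarrow> b \<in> M \<Longrightarrow> exp_dvd a b \<Longrightarrow> a = b"
  shows "minimal_generators n (Idl\<^bsub>poly_ring n\<^esub> (monom ` M)) = (monom ` M :: ('k::field) mpoly set)"
proof -
  let ?I = "Idl\<^bsub>poly_ring n\<^esub> (monom ` M) :: 'k mpoly set"
  have divisor: "\<exists>b\<in>N. exp_dvd b a"
    if "Idl\<^bsub>poly_ring n\<^esub> (monom ` L :: 'k mpoly set) = Idl\<^bsub>poly_ring n\<^esub> (monom ` N)"
      "L \<subseteq> exponents n" "N \<subseteq> exponents n" "a \<in> L" for L N a
  proof -
    have "(monom a :: 'k mpoly) \<in> Idl\<^bsub>poly_ring n\<^esub> (monom ` L)"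
      using monom_in_genideal[of L n a, where ?'k='k] that exp_dvd_def by blast
    then show ?thesis
      using monom_in_genideal[of N n a, where ?'k='k] that by auto
  qed
  have "is_minimal_monomial_generating_set n ?I (monom ` M)"
    unfolding is_minimal_monomial_generating_set_def
  proof (intro conjI allI impI notI)
    fix G' :: "'k mpoly set"
    assume G': "G' \<subset> monom ` M" and eq: "Idl\<^bsub>poly_ring n\<^esub> G' = ?I"
    then obtain N where N: "N \<subseteq> M" "G' = monom ` N"
      by (auto simp: subset_image_iff psubset_eq)
    then obtain a where a: "a \<in> M" "a \<notin> N" using G' by auto
    obtain b where "b \<in> N" "exp_dvd b a"
      using divisor[of M N a] eq N M a by auto
    then show False using antichain a N by blast
  qed (use M in auto)
  moreover have "G = monom ` M"
    if G: "is_minimal_monomial_generating_set n ?I G" for G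
  proof -
    from G obtain N where N: "N \<subseteq> exponents n" "G = monom ` N"
      by (auto simp: is_minimal_monomial_generating_set_def subset_image_iff)
    from G have eq: "Idl\<^bsub>poly_ring n\<^esub> (monom ` N) = ?I"
      by (simp add: is_minimal_monomial_generating_set_def N)
    have "M \<subseteq> N"
    proof
      fix a assume a: "a \<in> M"
      obtain b where b: "b \<in> N" "exp_dvd b a" using divisor[of M N a] eq M N a by auto
      obtain c where c: "c \<in> M" "exp_dvd c b" using divisor[of N M b] eq M N b by auto
      have "c = a" using antichain[OF c(1) a] exp_dvd_trans c b by blast
      then show "a \<in> N" using exp_dvd_antisym b c by blast
    qed
    then show ?thesis
      using G N unfolding is_minimal_monomial_generating_set_def by (metis image_mono psubsetI)
  qed
  ultimately show ?thesis
    unfolding minimal_generators_def by (rule the_equality)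
qed

text \<open>
  Multiplication by a monomial \<open>m\<close> shifts the support injectively, so no terms of \<open>p * monom m\<close>
  cancel and each of them has to be a multiple of a generator.
\<close>
lemma colon_ideal_monomials:
  fixes M :: "(nat \<Rightarrow>\<^sub>0 nat) set"
  assumes M: "M \<subseteq> exponents n" and m: "m \<in> exponents n"
  shows "colon_ideal (poly_ring n) (Idl\<^bsub>poly_ring n\<^esub> (monom ` M))
      (Idl\<^bsub>poly_ring n\<^esub> {monom m :: ('k::field) mpoly}) =
    {p. Poly_Mapping.keys p \<subseteq> exponents n \<and>
        (\<forall>k\<in>Poly_Mapping.keys p. \<exists>a\<in>M. exp_dvd a (k + m))}"
    (is "?C = ?T")
proof -
  interpret cring "poly_ring n :: 'k mpoly ring" by (rule cring_poly_ring)
  have J: "Idl\<^bsub>poly_ring n\<^esub> {monom m :: 'k mpoly} =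
    {p. Poly_Mapping.keys p \<subseteq> exponents n \<and> (\<forall>k\<in>Poly_Mapping.keys p. exp_dvd m k)}"
    using genideal_monomials[of "{m}" n, where ?'k='k] m by simp
  note I = genideal_monomials[OF M, where ?'k='k]
  have "p \<in> ?T" if p: "p \<in> ?C" for p
  proof -
    have "p * monom m \<in> Idl\<^bsub>poly_ring n\<^esub> (monom ` M)"
      using p m by (simp add: colon_ideal_def J exp_dvd_def)
    moreover have "k + m \<in> Poly_Mapping.keys (p * monom m)" if "k \<in> Poly_Mapping.keys p" for k
    proof -
      have "p * monom m = (\<Sum>l\<in>Poly_Mapping.keys p. Poly_Mapping.single (l + m) (Poly_Mapping.lookup p l))"
        by (subst sum_of_terms) (simp add: sum_distrib_right monom_def mult_single)
      then show ?thesis using that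
        by (simp add: in_keys_iff lookup_sum lookup_single when_def sum.delta)
    qed
    ultimately show ?thesis using p by (auto simp: I colon_ideal_def)
  qed
  moreover have "p \<in> ?C" if p: "p \<in> ?T" for p
  proof -
    have "p * q \<in> Idl\<^bsub>poly_ring n\<^esub> (monom ` M)"
      if q: "q \<in> Idl\<^bsub>poly_ring n\<^esub> {monom m}" for q
    proof -
      have "\<exists>a\<in>M. exp_dvd a c" if "c \<in> Poly_Mapping.keys (p * q)" for c
      proof -
        obtain k l where kl: "k \<in> Poly_Mapping.keys p" "l \<in> Poly_Mapping.keys q" "c = k + l"
          using \<open>c \<in> _\<close> keys_mult[of p q] by blast
        obtain a where a: "a \<in> M" "exp_dvd a (k + m)" using p kl by auto
        have "exp_dvd (k + m) c" using kl q by (auto simp: J exp_dvd_def lookup_add)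
        then show ?thesis using a exp_dvd_trans by blast
      qed
      moreover have "p * q \<in> carrier (poly_ring n)"
        using m_closed[of p q] p q J by auto
      ultimately show ?thesis by (simp add: I)
    qed
    then show ?thesis using p by (simp add: colon_ideal_def)
  qed
  ultimately show ?thesis by blast
qed

section \<open>Squarefree monomials\<close>

definition set_exp :: "nat set \<Rightarrow> (nat \<Rightarrow>\<^sub>0 nat)"
  where "set_exp e = (\<Sum>k\<in>e. Poly_Mapping.single k 1)"

lemma lookup_set_exp: "finite e \<Longrightarrow> Poly_Mapping.lookup (set_exp e) x = (if x \<in> e then 1 else 0)"
  by (simp add: set_exp_def lookup_sum lookup_single when_def)

lemma prod_var: "finite e \<Longrightarrow> (\<Prod>k\<in>e. var k) = (monom (set_exp e) :: ('k::field) mpoly)"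
  by (induction rule: finite_induct)
    (simp_all add: var_def monom_def set_exp_def mult_single)

lemma exp_dvd_set_exp:
  "finite a \<Longrightarrow> finite b \<Longrightarrow> exp_dvd (set_exp a) (set_exp b) \<longleftrightarrow> a \<subseteq> b"
  by (auto simp: exp_dvd_def lookup_set_exp split: if_splits)

lemma set_exp_exponents: "e \<subseteq> {1..n} \<Longrightarrow> set_exp e \<in> exponents n"
proof -
  assume e: "e \<subseteq> {1..n}"
  then have "finite e" using finite_subset by blast
  then show ?thesis
    using e by (force simp: exponents_def in_keys_iff lookup_set_exp split: if_splits)
qed

text \<open>
  For squarefree monomials, linear quotients amount to an exchange property of the supports: each
  earlier set \<open>e\<^sub>j\<close> meets a singleton \<open>e\<^sub>l - e\<^sub>i = {x}\<close> cut out by some earlier \<open>e\<^sub>l\<close>. The variables of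
  these singletons then generate the colon ideal.
\<close>
lemma linear_quotients_criterion:
  fixes es :: "nat set list"
  assumes sub: "\<And>e. e \<in> set es \<Longrightarrow> e \<subseteq> {1..n}"
    and distinct: "distinct es"
    and antichain: "\<And>e f. e \<in> set es \<Longrightarrow> f \<in> set es \<Longrightarrow> e \<subseteq> f \<Longrightarrow> e = f"
    and exchange: "\<And>i j. j < i \<Longrightarrow> i < length es \<Longrightarrow>
      \<exists>l<i. \<exists>x\<in>es ! j. es ! l - es ! i = {x}"
  shows "has_linear_quotients n
    (Idl\<^bsub>poly_ring n\<^esub> ((\<lambda>e. \<Prod>k\<in>e. var k) ` set es) :: ('k::field) mpoly set)"
proof -
  have fin: "finite e" if "e \<in> set es" for e
    using sub[OF that] finite_subset by blast
  have gens: "(\<lambda>e. \<Prod>k\<in>e. var k) ` A = (monom ` set_exp ` A :: 'k mpoly set)" if "A \<subseteq> set es" for A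
    using that fin by (auto simp: prod_var image_image intro!: image_cong)
  have exps: "set_exp ` A \<subseteq> exponents n" if "A \<subseteq> set es" for A
    using that sub set_exp_exponents by blast
  have inj: "inj_on set_exp (set es)"
    by (rule inj_onI) (metis exp_dvd_set_exp fin order_refl subset_antisym)
  let ?us = "map (\<lambda>e. monom (set_exp e)) es :: 'k mpoly list"
  show ?thesis
    unfolding has_linear_quotients_def
  proof (intro exI[of _ ?us] conjI ballI)
    show "distinct ?us"
      using distinct inj inj_monom
      by (auto simp: distinct_map inj_on_def inj_def)
    have "minimal_generators n (Idl\<^bsub>poly_ring n\<^esub> (monom ` set_exp ` set es)) =
      (monom ` set_exp ` set es :: 'k mpoly set)"
    proof (rule minimal_generators_antichain)
      show "a = b" if "a \<in> set_exp ` set es" "b \<in> set_exp ` set es" "exp_dvd a b" for a b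
      proof -
        obtain e f where ef: "e \<in> set es" "f \<in> set es" "a = set_exp e" "b = set_exp f"
          using \<open>a \<in> _\<close> \<open>b \<in> _\<close> by blast
        then have "e \<subseteq> f"
          using that(3) exp_dvd_set_exp[OF fin fin] by blast
        then show ?thesis using antichain ef by blast
      qed
    qed (rule exps[OF order_refl])
    then show "set ?us = minimal_generators n (Idl\<^bsub>poly_ring n\<^esub> ((\<lambda>e. \<Prod>k\<in>e. var k) ` set es))"
      by (simp add: gens image_image)
  next
    fix i assume "i \<in> {1..<length ?us}"
    then have i: "i < length es" by simp
    let ?b = "es ! i"
    have b: "?b \<in> set es" using i by simp
    have take: "set (take i es) = (\<lambda>j. es ! j) ` {..<i}"
      using i by (simp add: nth_image[symmetric] lessThan_atLeast0)
    define X where "X = {x. \<exists>l<i. es ! l - ?b = {x}}"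
    have X: "X \<subseteq> {1..n}"
    proof
      fix x assume "x \<in> X"
      then obtain l where l: "l < i" "es ! l - ?b = {x}" by (auto simp: X_def)
      then have "es ! l \<subseteq> {1..n}" using sub[OF nth_mem[of l es]] i by simp
      then show "x \<in> {1..n}" using l(2) by blast
    qed
    have key: "(\<exists>a\<in>set_exp ` set (take i es). exp_dvd a (k + set_exp ?b)) \<longleftrightarrow>
      (\<exists>a\<in>(\<lambda>x. Poly_Mapping.single x 1) ` X. exp_dvd a k)" for k
    proof
      assume "\<exists>a\<in>set_exp ` set (take i es). exp_dvd a (k + set_exp ?b)"
      then obtain j where j: "j < i" "exp_dvd (set_exp (es ! j)) (k + set_exp ?b)"
        by (auto simp: take)
      from exchange[OF j(1) i] obtain l x where x: "l < i" "x \<in> es ! j" "es ! l - ?b = {x}"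
        by auto
      \<comment> \<open>The exponent of \<open>x\<close> is 1 in \<open>es ! j\<close> and 0 in \<open>es ! i\<close>, so \<open>k\<close> must supply it.\<close>
      have "1 \<le> Poly_Mapping.lookup k x"
        using j(2)[unfolded exp_dvd_def, rule_format, of x] x fin[OF b] fin[of "es ! j"] j i
        by (auto simp: lookup_add lookup_set_exp split: if_splits)
      then have "exp_dvd (Poly_Mapping.single x 1) k"
        by (simp add: exp_dvd_def lookup_single when_def)
      then show "\<exists>a\<in>(\<lambda>x. Poly_Mapping.single x 1) ` X. exp_dvd a k"
        using x by (auto simp: X_def)
    next
      assume "\<exists>a\<in>(\<lambda>x. Poly_Mapping.single x 1) ` X. exp_dvd a k"
      then obtain l x where x: "l < i" "es ! l - ?b = {x}" "exp_dvd (Poly_Mapping.single x 1) k"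
        by (auto simp: X_def)
      have "1 \<le> Poly_Mapping.lookup k x"
        using x(3)[unfolded exp_dvd_def, rule_format, of x] by (simp add: lookup_single)
      then have "exp_dvd (set_exp (es ! l)) (k + set_exp ?b)"
        using x i fin[OF b] fin[of "es ! l"]
        by (auto simp: exp_dvd_def lookup_add lookup_set_exp)
      then show "\<exists>a\<in>set_exp ` set (take i es). exp_dvd a (k + set_exp ?b)"
        using x by (auto simp: take)
    qed
    have "colon_ideal (poly_ring n) (Idl\<^bsub>poly_ring n\<^esub> (set (take i ?us)))
        (Idl\<^bsub>poly_ring n\<^esub> {?us ! i}) =
      colon_ideal (poly_ring n) (Idl\<^bsub>poly_ring n\<^esub> (monom ` set_exp ` set (take i es)))
        (Idl\<^bsub>poly_ring n\<^esub> {monom (set_exp ?b) :: 'k mpoly})"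
      using i by (simp add: take_map image_image)
    also have "\<dots> = {p. Poly_Mapping.keys p \<subseteq> exponents n \<and> (\<forall>k\<in>Poly_Mapping.keys p.
        \<exists>a\<in>set_exp ` set (take i es). exp_dvd a (k + set_exp ?b))}"
      by (rule colon_ideal_monomials)
        (use exps[OF set_take_subset] set_exp_exponents sub b in auto)
    also have "\<dots> = {p. Poly_Mapping.keys p \<subseteq> exponents n \<and> (\<forall>k\<in>Poly_Mapping.keys p.
        \<exists>a\<in>(\<lambda>x. Poly_Mapping.single x 1) ` X. exp_dvd a k)}"
      by (simp only: key)
    also have "\<dots> = Idl\<^bsub>poly_ring n\<^esub> (monom ` (\<lambda>x. Poly_Mapping.single x 1) ` X :: 'k mpoly set)"
      by (rule genideal_monomials[symmetric]) (use X in \<open>auto simp: exponents_def\<close>)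
    also have "\<dots> = Idl\<^bsub>poly_ring n\<^esub> (var ` X :: 'k mpoly set)"
      by (simp add: image_image var_def)
    finally show "\<exists>X\<subseteq>{1..n}. colon_ideal (poly_ring n) (Idl\<^bsub>poly_ring n\<^esub> (set (take i ?us)))
        (Idl\<^bsub>poly_ring n\<^esub> {?us ! i}) = Idl\<^bsub>poly_ring n\<^esub> (var ` X :: 'k mpoly set)"
      using X by blast
  qed
qed

section \<open>Spread edges as increasing sequences\<close>

text \<open>
  A list starts at index 0, so its entry \<open>i\<close> lies in part \<open>Suc i\<close>, and the gap between the entries
  \<open>i\<close> and \<open>Suc i\<close> is governed by \<open>t (Suc i)\<close>.
\<close>
definition spread_list :: "nat \<Rightarrow> (nat \<Rightarrow> int) \<Rightarrow> (nat \<Rightarrow> nat set) \<Rightarrow> nat list \<Rightarrow> bool"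
  where "spread_list d t V xs \<longleftrightarrow> length xs = d \<and> (\<forall>i<d. xs ! i \<in> V (Suc i)) \<and>
    (\<forall>i. Suc i < d \<longrightarrow> int (xs ! i) + t (Suc i) \<le> int (xs ! Suc i))"

lemma spread_edge_iff_list: "spread_edge d t V e \<longleftrightarrow> (\<exists>xs. spread_list d t V xs \<and> e = set xs)"
proof
  assume "spread_edge d t V e"
  then obtain k where k: "e = k ` {1..d}" "\<forall>j\<in>{1..d}. k j \<in> V j"
    "\<forall>j\<in>{2..d}. int (k j) - int (k (j - 1)) \<ge> t (j - 1)"
    by (auto simp: spread_edge_def)
  let ?xs = "map (\<lambda>i. k (Suc i)) [0..<d]"
  have "int (k (Suc i)) + t (Suc i) \<le> int (k (Suc (Suc i)))" if "Suc i < d" for i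
    using k(3)[rule_format, of "Suc (Suc i)"] that by simp
  then have "spread_list d t V ?xs"
    using k(2) by (auto simp: spread_list_def)
  moreover have "e = set ?xs"
    unfolding k(1) image_Suc_lessThan[symmetric]
    by (simp add: image_image atLeast0LessThan del: image_Suc_lessThan)
  ultimately show "\<exists>xs. spread_list d t V xs \<and> e = set xs" by blast
next
  assume "\<exists>xs. spread_list d t V xs \<and> e = set xs"
  then obtain xs where xs: "spread_list d t V xs" "e = set xs" by blast
  have "e = (\<lambda>j. xs ! (j - 1)) ` {1..d}"
  proof -
    have "(\<lambda>j. xs ! (j - 1)) ` {1..d} = (!) xs ` {..<length xs}"
      unfolding image_Suc_lessThan[symmetric] image_image
      using xs(1) by (simp add: spread_list_def)
    then show ?thesis by (simp add: xs(2) set_conv_nth image_def Bex_def conj_commute)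
  qed
  moreover have "t (j - 1) \<le> int (xs ! (j - 1)) - int (xs ! (j - 1 - 1))" if "j \<in> {2..d}" for j
  proof -
    define i where "i = j - 2"
    have "j = Suc (Suc i)" using that unfolding i_def atLeastAtMost_iff by arith
    moreover from this have "int (xs ! i) + t (Suc i) \<le> int (xs ! Suc i)"
      using xs(1) that by (simp add: spread_list_def)
    ultimately show ?thesis by simp
  qed
  moreover have "xs ! (j - 1) \<in> V j" if "j \<in> {1..d}" for j
    using xs(1) that unfolding spread_list_def by (cases j) auto
  ultimately show "spread_edge d t V e"
    unfolding spread_edge_def by (intro exI[of _ "\<lambda>j. xs ! (j - 1)"]) blast
qed

lemma spread_list_sorted:
  assumes "\<And>i. i \<in> {1..d - 1} \<Longrightarrow> t i \<ge> 1" "spread_list d t V xs"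
  shows "sorted_wrt (<) xs"
  unfolding sorted_wrt_iff_nth_Suc_transp[OF transp_on_less]
proof (intro allI impI)
  fix i assume "Suc i < length xs"
  then show "xs ! i < xs ! Suc i"
    using assms(1)[of "Suc i"] assms(2) by (force simp: spread_list_def)
qed

text \<open>
  The position is the first one where the lists differ. Left of it the lists agree, so the new entry
  inherits its left gap from \<open>xs\<close>; lowering the entry can only widen its right gap.
\<close>
lemma spread_list_exchange:
  assumes xs: "spread_list d t V xs" and ys: "spread_list d t V ys" and less: "xs < ys"
  shows "\<exists>p<d. ys[p := xs ! p] < ys \<and> xs ! p < ys ! p \<and> spread_list d t V (ys[p := xs ! p])"
proof -
  have len: "length xs = d" "length ys = d" using xs ys by (auto simp: spread_list_def)
  obtain p where p: "p < d" "take p xs = take p ys" "xs ! p < ys ! p"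
    using less len by (auto simp: list_less_def lexord_take_index_conv)
  let ?zs = "ys[p := xs ! p]"
  have prefix: "xs ! i = ys ! i" if "i < p" for i
    using p(2) that by (metis nth_take)
  have "?zs < ys"
    unfolding list_less_def lexord_take_index_conv
    using p len by auto
  moreover have "spread_list d t V ?zs"
    unfolding spread_list_def
  proof (intro conjI allI impI)
    show "?zs ! i \<in> V (Suc i)" if "i < d" for i
      using that xs ys len p(1) by (cases "i = p") (auto simp: spread_list_def)
    show "int (?zs ! i) + t (Suc i) \<le> int (?zs ! Suc i)" if i: "Suc i < d" for i
    proof -
      have "int (xs ! i) + t (Suc i) \<le> int (xs ! Suc i)" "int (ys ! i) + t (Suc i) \<le> int (ys ! Suc i)"
        using xs ys i by (auto simp: spread_list_def)
      then show ?thesis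
        using p(1,3) prefix[of i] len by (auto simp: nth_list_update)
    qed
  qed (simp add: len)
  ultimately show ?thesis using p by blast
qed

theorem theorem2p4:
  fixes n d :: nat and t :: "nat \<Rightarrow> int" and V :: "nat \<Rightarrow> nat set"
  assumes "n \<ge> 1" and "d \<ge> 1"
    and "\<And>i. i \<in> {1..d - 1} \<Longrightarrow> t i \<ge> 1"
    and "\<And>i. i \<in> {1..d} \<Longrightarrow> V i \<noteq> {} \<and> V i \<subseteq> {1..n}"
    and "disjoint_family_on V {1..d}"
    and "\<And>i j p q. i \<in> {1..d} \<Longrightarrow> j \<in> {1..d} \<Longrightarrow> i < j \<Longrightarrow> p \<in> V i \<Longrightarrow> q \<in> V j \<Longrightarrow> p < q"
    and "no_isolated_vertices (complete_spread_hypergraph d t V)"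
  shows "has_linear_quotients n
    (edge_ideal n (complete_spread_hypergraph d t V) :: ('k::field) mpoly set)"
proof -
  define L where "L = {xs. spread_list d t V xs}"
  have sub: "set xs \<subseteq> {1..n}" if "xs \<in> L" for xs
  proof
    fix x assume "x \<in> set xs"
    then obtain i where "i < length xs" "x = xs ! i"
      by (metis in_set_conv_nth)
    then show "x \<in> {1..n}"
      using that assms(4)[of "Suc i"] by (auto simp: L_def spread_list_def)
  qed
  have "L \<subseteq> {xs. set xs \<subseteq> {1..n} \<and> length xs = d}"
    using sub by (auto simp: L_def spread_list_def)
  then have fin: "finite L"
    by (rule finite_subset) (rule finite_lists_length_eq[OF finite_atLeastAtMost])
  have sorted: "sorted_wrt (<) xs" if "xs \<in> L" for xs
    using spread_list_sorted[OF assms(3)] that by (simp add: L_def)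
  \<comment> \<open>A strictly increasing list is determined by its set, so edges and lists correspond.\<close>
  then have inj: "inj_on set L"
    by (intro inj_onI) (metis strict_sorted_equal)
  have card: "card (set xs) = d" if "xs \<in> L" for xs
    using sorted[OF that] that
    by (simp add: strict_sorted_iff distinct_card L_def spread_list_def)
  let ?ls = "sorted_list_of_set L" and ?es = "map set (sorted_list_of_set L)"
  have "{e. spread_edge d t V e} = set ?es"
    using fin by (auto simp: spread_edge_iff_list L_def)
  moreover have "has_linear_quotients n
    (Idl\<^bsub>poly_ring n\<^esub> ((\<lambda>e. \<Prod>k\<in>e. var k) ` set ?es) :: 'k mpoly set)"
  proof (rule linear_quotients_criterion)
    show "distinct ?es" using inj fin by (simp add: distinct_map)
  next
    fix e f assume ef: "e \<in> set ?es" "f \<in> set ?es" "e \<subseteq> f"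
    then have "card e = card f" using card fin by auto
    with ef show "e = f" by (intro card_subset_eq) auto
  next
    fix i j assume ji: "j < i" and "i < length ?es"
    then have i: "i < length ?ls" by simp
    have strict: "sorted_wrt (<) ?ls"
      by (simp add: strict_sorted_iff)
    have mem: "?ls ! k \<in> L" if "k < length ?ls" for k
      using nth_mem[OF that] fin by simp
    let ?y = "?ls ! i" and ?x = "(!) (?ls ! j)"
    have less: "?ls ! j < ?y"
      using strict ji i by (rule sorted_wrt_nth_less)
    have "spread_list d t V (?ls ! j)" "spread_list d t V ?y"
      using mem[of j] mem[of i] i ji by (simp_all add: L_def)
    from spread_list_exchange[OF this less]
    obtain p where p: "p < d" "?y[p := ?x p] < ?y" "?x p < ?y ! p" "?y[p := ?x p] \<in> L"
      by (auto simp: L_def)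
    obtain l where l: "l < length ?ls" "?ls ! l = ?y[p := ?x p]"
      using p(4) fin by (metis in_set_conv_nth set_sorted_list_of_set)
    have "l < i"
      using l p(2) i strict sorted_wrt_nth_less[OF strict, of i l]
      by (metis less_asym less_irrefl linorder_neqE_nat)
    moreover have "?x p \<in> ?es ! j"
      using mem[of j] i ji p(1) by (auto simp: L_def spread_list_def)
    moreover have "?es ! l - ?es ! i = {?x p}"
    proof -
      have zs: "set (?y[p := ?x p]) \<subseteq> insert (?x p) (set ?y)"
        by (rule set_update_subset_insert)
      \<comment> \<open>Were \<open>?x p\<close> already in \<open>set ?y\<close>, the two edges of size \<open>d\<close> and hence the two lists would
        coincide.\<close>
      have "\<not> set (?y[p := ?x p]) \<subseteq> set ?y"
      proof
        assume "set (?y[p := ?x p]) \<subseteq> set ?y"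
        then have "set (?y[p := ?x p]) = set ?y"
          using card mem[OF i] p(4) by (intro card_subset_eq) auto
        then have "?y[p := ?x p] = ?y" using inj mem[OF i] p(4) by (auto dest: inj_onD)
        then show False using p(2) by simp
      qed
      then show ?thesis using zs l i by auto
    qed
    ultimately show "\<exists>l<i. \<exists>x\<in>?es ! j. ?es ! l - ?es ! i = {x}" by blast
  qed (use sub fin in auto)
  ultimately show ?thesis
    by (simp add: edge_ideal_def complete_spread_hypergraph_def)
qed

end
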